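(* Let $J,R,Q\in\mathbb R^{n\times n}$, $B\in\mathbb R^{n\times m}$ with $J^\top=-J$, $R=R^\top\succeq0$, $Q=Q^\top\succ0$ define a port-Hamiltonian system with $A=(J-R)Q$ asymptotically stable, $C=B^\top Q$, and $(A,R,C)$ minimal (i.e. $(A,R)$ controllable and $(A,C)$ observable), which is balanced with respect to the solutions $\mathcal L_{\mathrm c},\mathcal M_{\mathrm o}$ of $$A\mathcal L_{\mathrm c}+\mathcal L_{\mathrm c}A^\top+2R=0,\qquad A^\top\mathcal M_{\mathrm o}+\mathcal M_{\mathrm o}A+C^\top C=0,$$ i.e. $\mathcal M_{\mathrm o}=\mathcal L_{\mathrm c}=\Pi=\mathrm{diag}(\Pi_1,\Pi_2)$ is diagonal with $\Pi_1=\mathrm{diag}(\pi_1,\dots,\pi_r)$, $\Pi_2=\mathrm{diag}(\pi_{r+1},\dots,\pi_n)$. Let $(\widehat A_r,\widehat B_r,\widehat C_r)$ be the reduced-order model of order $r$ obtained by truncation of $(A,B,C)$. If $V(s)=C(sI_n-A)^{-1}L_R^\top$ and $\widehat V_r(s)=\widehat C_r(sI_r-\widehat A_r)^{-1}\widehat L_{\widehat R_r}^\top$ are the spectral factors of the associated Popov functions (see context), then $$\|V-\widehat V_r\|_{\mathcal H_\infty}\le2\sum_{i=r+1}^n\pi_i.$$ Moreover, the reduced-order model $(\widehat A_r,\widehat B_r,\widehat C_r)$ is port-Hamiltonian.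
   Context: Asymptotically stable: all eigenvalues of $A$ lie in the open left half plane. Truncation: $\widehat A_r$ is the leading $r\times r$ block of $A$, $\widehat B_r$ consists of the first $r$ rows of $B$, $\widehat C_r$ of the first $r$ columns of $C$. A system $(\mathcal A,\mathcal B,\mathcal C)$ is port-Hamiltonian if there are $\mathcal J=-\mathcal J^\top$, $\mathcal R=\mathcal R^\top\succeq0$, $\mathcal Q=\mathcal Q^\top\succ0$ with $\mathcal A=(\mathcal J-\mathcal R)\mathcal Q$, $\mathcal C=\mathcal B^\top\mathcal Q$. $L_R$ is a factor with $2R=L_R^\top L_R$, and $\widehat L_{\widehat R_r}^\top=\begin{bmatrix}I_r&0\end{bmatrix}L_R^\top$ consists of the first $r$ rows of $L_R^\top$, so that $\widehat L_{\widehat R_r}^\top\widehat L_{\widehat R_r}=2\widehat R_r$ with $\widehat R_r$ the leading $r\times r$ block of $R$, and $L_R^\top$, $\widehat L_{\widehat R_r}^\top$ have the same number of columns. The Popov function of $G(s)=C(sI_n-A)^{-1}B$ is $\Phi(s)=G(-s)^\top+G(s)$; $V$ is a spectral factor in the sense that $\Phi(s)=V(s)V(-s)^\top$, and analogously for the reduced system. $\|F\|_{\mathcal H_\infty}=\sup_{z\in\mathbb C_+}\|F(z)\|_2$, with $\mathbb C_+$ the open right half plane and $\|\cdot\|_2$ the spectral norm. *)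

theory Defs
  imports "HOL-Analysis.Analysis"
begin

text \<open>
  A matrix with \<open>m\<close> rows and \<open>n\<close> columns has type \<^typ>\<open>real^'n^'m\<close>. A state space of dimension
  \<open>n\<close> together with a reduced order \<open>r < n\<close> is indexed by a sum type \<open>'r + 'q\<close>: \<open>Inl\<close> gives the
  first \<open>r\<close> indices and \<open>Inr\<close> the remaining \<open>n - r\<close> ones.
\<close>

definition diag :: "('n::finite \<Rightarrow> real) \<Rightarrow> real^'n^'n" where
  "diag d = (\<chi> i j. if i = j then d i else 0)"

definition pos_semidef :: "real^'n^'n \<Rightarrow> bool" where
  "pos_semidef M \<longleftrightarrow> transpose M = M \<and> (\<forall>x. 0 \<le> x \<bullet> (M *v x))"

definition pos_def :: "real^'n^'n \<Rightarrow> bool" where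
  "pos_def M \<longleftrightarrow> transpose M = M \<and> (\<forall>x. x \<noteq> 0 \<longrightarrow> 0 < x \<bullet> (M *v x))"

abbreviation cmat :: "real^'n^'m \<Rightarrow> complex^'n^'m" where
  "cmat \<equiv> map_matrix complex_of_real"

definition is_eigenvalue :: "real^'n^'n \<Rightarrow> complex \<Rightarrow> bool" where
  "is_eigenvalue A z \<longleftrightarrow> (\<exists>v. v \<noteq> 0 \<and> cmat A *v v = z *s v)"

definition asymptotically_stable :: "real^'n^'n \<Rightarrow> bool" where
  "asymptotically_stable A \<longleftrightarrow> (\<forall>z. is_eigenvalue A z \<longrightarrow> Re z < 0)"

text \<open>
  Kalman's conditions: \<open>[B, A B, \<dots>, A\<^sup>n\<^sup>-\<^sup>1 B]\<close>, respectively the stack of \<open>C, C A, \<dots>, C A\<^sup>n\<^sup>-\<^sup>1\<close>, has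
  rank \<open>n\<close>. Function iteration is used because \<open>^\<close> on \<^typ>\<open>real^'n^'n\<close> is the entrywise power.
\<close>

definition controllable :: "real^'n^'n \<Rightarrow> real^'m^'n \<Rightarrow> bool" where
  "controllable A B \<longleftrightarrow>
     span (\<Union>k<CARD('n). columns (((\<lambda>M. A ** M) ^^ k) B)) = UNIV"

definition observable :: "real^'n^'n \<Rightarrow> real^'n^'p \<Rightarrow> bool" where
  "observable A C \<longleftrightarrow>
     span (\<Union>k<CARD('n). rows (((\<lambda>M. M ** A) ^^ k) C)) = UNIV"

definition port_hamiltonian_with ::
    "real^'n^'n \<Rightarrow> real^'n^'n \<Rightarrow> real^'n^'n \<Rightarrow> real^'n^'n \<Rightarrow> real^'m^'n \<Rightarrow> real^'n^'m \<Rightarrow> bool" where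
  "port_hamiltonian_with J R Q A B C \<longleftrightarrow>
     transpose J = - J \<and> pos_semidef R \<and> pos_def Q \<and> A = (J - R) ** Q \<and> C = transpose B ** Q"

definition port_hamiltonian :: "real^'n^'n \<Rightarrow> real^'m^'n \<Rightarrow> real^'n^'m \<Rightarrow> bool" where
  "port_hamiltonian A B C \<longleftrightarrow> (\<exists>J R Q. port_hamiltonian_with J R Q A B C)"

definition first_rows :: "real^'m^('r::finite + 'q::finite) \<Rightarrow> real^'m^'r" where
  "first_rows M = (\<chi> i j. M $ Inl i $ j)"

definition first_columns :: "real^('r::finite + 'q::finite)^'p \<Rightarrow> real^'r^'p" where
  "first_columns M = (\<chi> i j. M $ i $ Inl j)"

definition leading_block :: "real^('r::finite + 'q::finite)^('r::finite + 'q::finite) \<Rightarrow> real^'r^'r" where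
  "leading_block M = (\<chi> i j. M $ Inl i $ Inl j)"

text \<open>\<open>C (s I - A)\<^sup>-\<^sup>1 B\<close>, meaningful whenever \<open>s\<close> is not an eigenvalue of \<open>A\<close>.\<close>

definition transfer ::
    "real^'n^'n \<Rightarrow> real^'m^'n \<Rightarrow> real^'n^'p \<Rightarrow> complex \<Rightarrow> complex^'m^'p" where
  "transfer A B C s = cmat C ** matrix_inv (mat s - cmat A) ** cmat B"

definition popov ::
    "real^'n^'n \<Rightarrow> real^'m^'n \<Rightarrow> real^'n^'m \<Rightarrow> complex \<Rightarrow> complex^'m^'m" where
  "popov A B C s = transpose (transfer A B C (- s)) + transfer A B C s"

text \<open>
  The factorization is an identity of rational functions; it is required at every \<open>s\<close> at which
  neither \<open>s\<close> nor \<open>-s\<close> is an eigenvalue of \<open>A\<close>.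
\<close>

definition popov_spectral_factor ::
    "(complex \<Rightarrow> complex^'p^'m) \<Rightarrow> real^'n^'n \<Rightarrow> real^'m^'n \<Rightarrow> real^'n^'m \<Rightarrow> bool" where
  "popov_spectral_factor V A B C \<longleftrightarrow>
     (\<forall>s. \<not> is_eigenvalue A s \<and> \<not> is_eigenvalue A (- s) \<longrightarrow>
        popov A B C s = V s ** transpose (V (- s)))"

text \<open>Extended-real valued, so that a bound on the norm includes boundedness on the half plane.\<close>

definition Hinf_norm :: "(complex \<Rightarrow> complex^'m^'p) \<Rightarrow> ereal" where
  "Hinf_norm F = (SUP z\<in>{z. 0 < Re z}. ereal (onorm (\<lambda>x. F z *v x)))"

end

(*
  The matrices X = inverse Q and Pi both solve A X + X A^T + 2 R = 0. Their difference D satisfies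
  R Q D = 0, by taking the trace against Q D Q, and D Q commutes with A, so D Q annihilates the
  controllability matrix of (A, R) and Q = inverse Pi is diagonal. Hence truncation preserves both
  the port-Hamiltonian structure and the Lyapunov equation that yields the spectral factorization.

  For the error bound, states are removed one at a time. At a frequency z with Re z > 0 and input u,
  let x and w be the states before and after removing the index k, and put d = x - w, s = x + w. The
  cross terms cancel in the balance of the storage <d, Pi d> + pi_k^2 <s, inverse Pi s>, which leaves
  |C d|^2 <= 4 pi_k^2 |u|^2.
*)

theory Submission
  imports Defs
begin

section \<open>Ring and transpose laws for rectangular matrices\<close>

lemma matrix_add_rdistrib: "(A + B) ** C = A ** C + B ** C"
  for A :: "'a::semiring_1^'n^'m"
  by (vector matrix_matrix_mult_def sum.distrib[symmetric] distrib_right)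

lemma matrix_diff_ldistrib: "A ** (B - C) = A ** B - A ** C"
  for A :: "'a::ring_1^'n^'m"
  by (vector matrix_matrix_mult_def sum_subtractf[symmetric] right_diff_distrib)

lemma matrix_diff_rdistrib: "(A - B) ** C = A ** C - B ** C"
  for A :: "'a::ring_1^'n^'m"
  by (vector matrix_matrix_mult_def sum_subtractf[symmetric] left_diff_distrib)

lemma matrix_minus_left: "(- A) ** B = - (A ** B)"
  for A :: "'a::ring_1^'n^'m"
  by (vector matrix_matrix_mult_def sum_negf[symmetric])

lemma matrix_minus_right: "A ** (- B) = - (A ** B)"
  for A :: "'a::ring_1^'n^'m"
  by (vector matrix_matrix_mult_def sum_negf[symmetric])

lemma transpose_add: "transpose (A + B) = transpose A + transpose B"
  by (vector transpose_def)

lemma transpose_diff: "transpose (A - B) = transpose A - transpose B"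
  by (vector transpose_def)

lemma transpose_minus: "transpose (- A) = - transpose A"
  by (vector transpose_def)

lemmas matrix_ring_simps = matrix_add_ldistrib matrix_add_rdistrib matrix_diff_ldistrib
  matrix_diff_rdistrib matrix_minus_left matrix_minus_right matrix_mul_assoc

lemmas transpose_simps = transpose_add transpose_diff transpose_minus matrix_transpose_mul

section \<open>Uniqueness of the Lyapunov solution for a port-Hamiltonian system\<close>

lemma trace_congruence:
  fixes N :: "real^'n^'m" and Q :: "real^'n^'n"
  shows "trace (N ** Q ** transpose N) = (\<Sum>i\<in>UNIV. row i N \<bullet> (Q *v row i N))"
proof -
  have "(N ** (Q ** transpose N)) $ i $ i = row i N \<bullet> (Q *v row i N)" for i
    by (simp add: matrix_matrix_mult_def matrix_vector_mult_def inner_vec_def row_def transpose_def)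
  then show ?thesis
    by (simp add: trace_def matrix_mul_assoc)
qed

text \<open>The trace sums the nonnegative values of the form \<open>Q\<close> at the rows of
  \<open>N\<close>, so every row must vanish.\<close>

lemma trace_congruence_eq_0:
  fixes N :: "real^'n^'m"
  assumes "pos_def Q" "trace (N ** Q ** transpose N) = 0"
  shows "N = 0"
proof -
  have nonneg: "0 \<le> v \<bullet> (Q *v v)" for v
    using assms(1) unfolding pos_def_def by (cases "v = 0") (auto intro: less_imp_le)
  have "row i N \<bullet> (Q *v row i N) = 0" for i
    using assms(2) nonneg by (simp add: trace_congruence sum_nonneg_eq_0_iff)
  then have "row i N = 0" for i
    using assms(1) unfolding pos_def_def by (metis less_irrefl)
  then show ?thesis
    by (simp add: vec_eq_iff row_def)
qed

text \<open>Since \<open>N\<close> commutes with \<open>A\<close>, it moves past every factor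
  \<open>A\<close> and reaches \<open>R\<close>, where it gives zero. Its kernel thus contains all
  columns of the Kalman matrix, which span the space.\<close>

lemma controllable_annihilator:
  fixes A R N :: "real^'n^'n"
  assumes "controllable A R" "N ** R = 0" "N ** A = A ** N"
  shows "N = 0"
proof -
  have pow: "N ** ((\<lambda>M. A ** M) ^^ k) R = 0" for k
    by (induction k) (simp_all add: assms matrix_mul_assoc, metis matrix_mul_assoc times0_right)
  have "c \<in> {v. N *v v = 0}" if c: "c \<in> (\<Union>k<CARD('n). columns (((\<lambda>M. A ** M) ^^ k) R))" for c
  proof -
    obtain k i where "c = column i (((\<lambda>M. A ** M) ^^ k) R)"
      using c unfolding columns_def by blast
    moreover have "N *v column i M = column i (N ** M)" for M
      by (simp add: column_def matrix_vector_mult_def matrix_matrix_mult_def)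
    moreover have "column i (0 :: real^'n^'n) = 0"
      by (simp add: column_def vec_eq_iff)
    ultimately show ?thesis
      by (simp add: pow)
  qed
  moreover have "subspace {v. N *v v = 0}"
    by (simp add: subspace_def algebra_simps)
  ultimately have "span (\<Union>k<CARD('n). columns (((\<lambda>M. A ** M) ^^ k) R)) \<subseteq> {v. N *v v = 0}"
    by (intro span_minimal) blast
  then show ?thesis
    using assms(1) by (auto simp: controllable_def matrix_eq)
qed

text \<open>Testing the equation against \<open>Q ** D ** Q\<close> under the trace cancels
  \<open>J\<close> and leaves a definite expression in \<open>L ** Q ** D\<close>, so
  \<open>R ** Q ** D = 0\<close>. What remains of the equation makes \<open>D ** Q\<close> commute
  with \<open>A\<close>, and controllability finishes the argument.\<close>

lemma port_hamiltonian_lyapunov_homogeneous: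
  fixes J R Q A D :: "real^'n^'n" and B :: "real^'m^'n" and L :: "real^'n^'p"
  assumes ph: "port_hamiltonian_with J R Q A B C"
    and ctrl: "controllable A R"
    and factor: "2 *\<^sub>R R = transpose L ** L"
    and sym: "transpose D = D"
    and lyap: "A ** D + D ** transpose A = 0"
  shows "D ** Q = 0"
proof -
  have J: "transpose J = - J" and R: "transpose R = R" and Q: "transpose Q = Q" "pos_def Q"
    and A: "A = (J - R) ** Q"
    using ph by (auto simp: port_hamiltonian_with_def pos_semidef_def pos_def_def)
  define F where "F = Q ** D"
  define S where "S = F ** Q ** transpose F"
  have F: "transpose F = D ** Q"
    by (simp add: F_def transpose_simps Q sym)
  have At: "transpose A = Q ** (- J - R)"
    by (simp add: A transpose_simps J R Q)
  have "0 = trace (Q ** D ** Q ** (A ** D + D ** transpose A))"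
    using lyap by (simp add: trace_def)
  also have "\<dots> = trace ((Q ** D ** Q ** (J - R)) ** (Q ** D))
      + trace ((Q ** D ** Q ** D ** Q) ** (- J - R))"
    by (simp only: At) (simp add: A matrix_add_ldistrib trace_add matrix_mul_assoc)
  \<comment> \<open>Cyclicity gives both terms the same symmetric left factor \<open>S\<close>, so
    that \<open>J\<close> and \<open>- J\<close> cancel in the sum.\<close>
  also have "trace ((Q ** D ** Q ** (J - R)) ** (Q ** D))
      = trace ((Q ** D) ** (Q ** D ** Q ** (J - R)))"
    by (rule trace_mul_sym)
  also have "(Q ** D) ** (Q ** D ** Q ** (J - R)) = S ** (J - R)"
    unfolding S_def F by (simp add: F_def matrix_mul_assoc)
  also have "Q ** D ** Q ** D ** Q = S"
    unfolding S_def F by (simp add: F_def matrix_mul_assoc)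
  also have "trace (S ** (J - R)) + trace (S ** (- J - R)) = trace (- (S ** (2 *\<^sub>R R)))"
    by (simp only: scaleR_2 matrix_diff_ldistrib matrix_minus_right matrix_add_ldistrib flip: trace_add)
      simp
  also have "\<dots> = - trace (S ** (2 *\<^sub>R R))"
    by (simp add: trace_def sum_negf)
  also have "trace (S ** (2 *\<^sub>R R)) = trace ((L ** F) ** Q ** transpose (L ** F))"
    using trace_mul_sym[of "S ** transpose L" L]
    by (simp add: factor S_def transpose_simps matrix_mul_assoc)
  finally have "L ** F = 0"
    using trace_congruence_eq_0[OF Q(2), of "L ** F"] by simp
  then have "(2 *\<^sub>R R) ** F = 0"
    by (simp add: factor flip: matrix_mul_assoc)
  then have RF: "R ** F = 0"
    by (simp flip: scalar_matrix_assoc)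
  have FR: "transpose F ** R = 0"
    using arg_cong[OF RF, of transpose] R by (simp add: transpose_simps) (simp add: transpose_def vec_eq_iff)
  \<comment> \<open>With all terms in \<open>R\<close> gone, the Lyapunov equation reads
    \<open>J ** F = transpose F ** J\<close>. Multiplied by \<open>Q\<close> on the right, this is
    the commutation of \<open>D ** Q\<close> with \<open>A\<close>.\<close>
  have AD: "A ** D = J ** F"
    using RF by (simp add: A F_def matrix_ring_simps)
  have "D ** transpose A = - (transpose F ** J)"
    using FR by (simp add: At F matrix_ring_simps)
  then have JF: "J ** F = transpose F ** J"
    using lyap AD by simp
  have "transpose F ** A = transpose F ** J ** Q"
    using FR by (simp add: A matrix_ring_simps)
  also have "\<dots> = A ** transpose F"
    unfolding F by (simp add: AD matrix_mul_assoc JF[symmetric, unfolded F])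
  finally show ?thesis
    using controllable_annihilator[OF ctrl FR] by (simp add: F)
qed

lemma pos_def_invertible:
  assumes "pos_def Q"
  shows "invertible Q"
proof -
  have "\<forall>x. Q *v x = 0 \<longrightarrow> x = 0"
    using assms unfolding pos_def_def by (metis inner_zero_right less_irrefl)
  then show ?thesis
    by (simp add: invertible_left_inverse matrix_left_invertible_ker)
qed

text \<open>The inverse of \<open>Q\<close> solves the same Lyapunov equation, because
  \<open>J\<close> cancels there; its difference from \<open>X\<close> solves the homogeneous
  equation.\<close>

lemma port_hamiltonian_gramian:
  fixes J R Q A X :: "real^'n^'n" and B :: "real^'m^'n" and L :: "real^'n^'p"
  assumes ph: "port_hamiltonian_with J R Q A B C"
    and ctrl: "controllable A R"
    and factor: "2 *\<^sub>R R = transpose L ** L"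
    and sym: "transpose X = X"
    and lyap: "A ** X + X ** transpose A + 2 *\<^sub>R R = 0"
  shows "X ** Q = mat 1"
proof -
  have J: "transpose J = - J" and R: "transpose R = R" and Q: "transpose Q = Q" "pos_def Q"
    and A: "A = (J - R) ** Q"
    using ph by (auto simp: port_hamiltonian_with_def pos_semidef_def pos_def_def)
  obtain Y where Y: "Y ** Q = mat 1" "Q ** Y = mat 1"
    using pos_def_invertible[OF Q(2)] by (auto simp: invertible_def)
  have "transpose Y ** Q = mat 1"
    using arg_cong[OF Y(2), of transpose] by (simp add: transpose_simps Q)
  then have Yt: "transpose Y = Y"
    by (metis Y(2) matrix_mul_assoc matrix_mul_lid matrix_mul_rid)
  have "A ** Y + Y ** transpose A = (J - R) ** (Q ** Y) + (Y ** Q) ** (- J - R)"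
    by (simp add: A transpose_simps J R Q matrix_mul_assoc del: Y)
  also have "\<dots> = - (2 *\<^sub>R R)"
    by (simp add: Y scaleR_2)
  finally have "A ** (X - Y) + (X - Y) ** transpose A = 0"
    using lyap by (simp add: matrix_diff_ldistrib matrix_diff_rdistrib algebra_simps)
  then have "(X - Y) ** Q = 0"
    using port_hamiltonian_lyapunov_homogeneous[OF ph ctrl factor, of "X - Y"]
    by (simp add: transpose_simps sym Yt)
  then show ?thesis
    by (simp add: matrix_diff_rdistrib Y)
qed

section \<open>Complexified real matrices, diagonal matrices and the energy identity\<close>

lemma cmat_mult: "cmat (M ** N) = cmat M ** cmat N"
  by (simp add: vec_eq_iff matrix_matrix_mult_def)

lemma cmat_add: "cmat (M + N) = cmat M + cmat N"
  by (simp add: vec_eq_iff)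

lemma cmat_transpose: "cmat (transpose M) = transpose (cmat M)"
  by (simp add: vec_eq_iff transpose_def)

lemma cmat_0: "cmat 0 = 0"
  by (simp add: vec_eq_iff)

lemma diag_nth [simp]: "diag d $ i $ j = (if i = j then d i else 0)"
  by (simp add: diag_def)

lemma mult_diag_nth [simp]: "(M ** diag d) $ i $ j = M $ i $ j * d j"
  by (simp add: matrix_matrix_mult_def if_distrib cong: if_cong)

lemma diag_mult_nth [simp]: "(diag d ** M) $ i $ j = d i * M $ i $ j"
  by (simp add: matrix_matrix_mult_def if_distribR if_distrib cong: if_cong)

lemma transpose_diag [simp]: "transpose (diag d) = diag d"
  by (simp add: vec_eq_iff transpose_def)

lemma cmat_diag_mult_vec_nth [simp]: "(cmat (diag d) *v v) $ i = of_real (d i) * v $ i"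
  by (simp add: matrix_vector_mult_def if_distribR if_distrib cong: if_cong)

text \<open>On complex vectors \<open>inner\<close> is the real part of the Hermitian product, for
  which a real matrix has its transpose as adjoint.\<close>

lemma inner_cmat_right: "x \<bullet> (cmat M *v y) = (cmat (transpose M) *v x) \<bullet> y"
proof -
  have "x \<bullet> (cmat M *v y) = (\<Sum>i\<in>UNIV. \<Sum>j\<in>UNIV. M $ i $ j * (x $ i \<bullet> y $ j))"
    by (simp add: inner_vec_def matrix_vector_mult_def inner_sum_right inner_complex_def
        sum_distrib_left sum.distrib algebra_simps)
  also have "\<dots> = (\<Sum>j\<in>UNIV. \<Sum>i\<in>UNIV. M $ i $ j * (x $ i \<bullet> y $ j))"
    by (rule sum.swap)
  also have "\<dots> = (cmat (transpose M) *v x) \<bullet> y"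
    by (simp add: inner_vec_def matrix_vector_mult_def inner_sum_left inner_complex_def transpose_def
        sum_distrib_left sum.distrib algebra_simps del: transpose_matrix_vector)
  finally show ?thesis .
qed

text \<open>The quadratic form of the Lyapunov equation at \<open>v\<close>: its first two terms
  contribute equally, which explains the factor 2. This is the energy balance behind all later
  estimates.\<close>

lemma lyapunov_inner:
  assumes "transpose A ** P + P ** A + transpose C ** C = 0" "transpose P = P"
  shows "2 * ((cmat P *v v) \<bullet> (cmat A *v v)) = - (norm (cmat C *v v))\<^sup>2"
proof -
  have "(cmat P *v v) \<bullet> (cmat A *v v) = v \<bullet> (cmat (P ** A) *v v)"
    by (simp add: cmat_mult inner_cmat_right[of v P] assms(2) flip: matrix_vector_mul_assoc)
  moreover have "v \<bullet> (cmat (P ** A) *v v) = v \<bullet> (cmat (transpose A ** P) *v v)"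
    by (subst inner_cmat_right) (simp add: transpose_simps assms(2) inner_commute)
  moreover have "v \<bullet> (cmat (transpose C ** C) *v v) = (norm (cmat C *v v))\<^sup>2"
    by (simp add: cmat_mult inner_cmat_right[of v "transpose C"] power2_norm_eq_inner
        del: transpose_matrix_vector flip: matrix_vector_mul_assoc)
  moreover have "v \<bullet> (cmat (transpose A ** P + P ** A + transpose C ** C) *v v) = 0"
    by (simp add: assms(1) cmat_0)
  ultimately show ?thesis
    by (simp add: cmat_add matrix_vector_mult_add_rdistrib inner_add_right)
qed

section \<open>States of truncated systems and the error of removing indices\<close>

text \<open>The states of the system truncated to the indices in \<open>S\<close>, extended by zero, under the
  input \<open>f\<close> at the frequency \<open>z\<close>.\<close>

definition trunc_state ::
    "real^'n^'n \<Rightarrow> 'n set \<Rightarrow> complex \<Rightarrow> complex^'n \<Rightarrow> complex^'n \<Rightarrow> bool" where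
  "trunc_state A S z f x \<longleftrightarrow>
     (\<forall>i. if i \<in> S then z * x $ i = (cmat A *v x) $ i + f $ i else x $ i = 0)"

text \<open>The energy balance bounds \<open>Re z\<close> times the weighted squared norm of
  \<open>x\<close> by zero. This gives uniqueness of truncated states and, later, invertibility of
  both resolvents.\<close>

lemma trunc_state_homogeneous:
  fixes A :: "real^'n^'n" and C :: "real^'n^'p"
  assumes lyap: "transpose A ** diag p + diag p ** A + transpose C ** C = 0"
    and pos: "\<And>i. 0 < p i" and z: "0 < Re z"
    and x: "trunc_state A S z 0 x"
  shows "x = 0"
proof -
  have "(cmat (diag p) *v x) \<bullet> (z *s x) = (cmat (diag p) *v x) \<bullet> (cmat A *v x)"
    unfolding inner_vec_def
  proof (rule sum.cong[OF refl])
    fix i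
    \<comment> \<open>Outside \<open>S\<close> the entry of \<open>x\<close> is zero and so is its
      weighted entry; the state equation may therefore be used at every index.\<close>
    show "(cmat (diag p) *v x) $ i \<bullet> (z *s x) $ i = (cmat (diag p) *v x) $ i \<bullet> (cmat A *v x) $ i"
      using x[unfolded trunc_state_def, rule_format, of i] by (simp split: if_splits)
  qed
  also have "\<dots> \<le> 0"
    using lyapunov_inner[OF lyap transpose_diag, of x] zero_le_power2[of "norm (cmat C *v x)"]
    by linarith
  also have "(cmat (diag p) *v x) \<bullet> (z *s x) = Re z * (\<Sum>i\<in>UNIV. p i * (norm (x $ i))\<^sup>2)"
    by (simp add: inner_vec_def sum_distrib_left inner_complex_def cmod_power2)
       (simp add: algebra_simps power2_eq_square)
  finally have "(\<Sum>i\<in>UNIV. p i * (norm (x $ i))\<^sup>2) \<le> 0"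
    using z by (simp add: mult_le_0_iff)
  then have "(\<Sum>i\<in>UNIV. p i * (norm (x $ i))\<^sup>2) = 0"
    using pos by (intro antisym sum_nonneg) (simp_all add: less_imp_le)
  then have "p i * (norm (x $ i))\<^sup>2 = 0" for i
    using pos by (subst (asm) sum_nonneg_eq_0_iff) (simp_all add: less_imp_le)
  then show ?thesis
    using pos by (simp add: vec_eq_iff) (metis less_irrefl)
qed

text \<open>The state solves a square linear system, so the uniqueness just shown yields
  existence.\<close>

lemma trunc_state_exists:
  fixes A :: "real^'n^'n" and C :: "real^'n^'p"
  assumes lyap: "transpose A ** diag p + diag p ** A + transpose C ** C = 0"
    and pos: "\<And>i. 0 < p i" and z: "0 < Re z"
  shows "\<exists>x. trunc_state A S z f x"
proof -
  \<comment> \<open>The rows outside \<open>S\<close> are those of \<open>mat z\<close>; as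
    \<open>z\<close> is nonzero, they force the entries there to vanish.\<close>
  define F where "F = mat z - (\<chi> i j. if i \<in> S then cmat A $ i $ j else 0)"
  have F: "(F *v x) $ i = z * x $ i - (if i \<in> S then (cmat A *v x) $ i else 0)" for x i
  proof -
    have "(mat z *v x) $ i = z * x $ i"
      by (simp add: matrix_vector_mult_def mat_def if_distribR if_distrib cong: if_cong)
    moreover have "((\<chi> i j. if i \<in> S then cmat A $ i $ j else 0) *v x) $ i
        = (if i \<in> S then (cmat A *v x) $ i else 0)"
      by (simp add: matrix_vector_mult_def)
    ultimately show ?thesis
      by (simp add: F_def matrix_vector_mult_diff_rdistrib)
  qed
  have z0: "z \<noteq> 0"
    using z by auto
  have "x = 0" if "F *v x = 0" for x
  proof (rule trunc_state_homogeneous[OF lyap pos z])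
    have "if i \<in> S then z * x $ i = (cmat A *v x) $ i + 0 $ i else x $ i = 0" for i
      using F[of x i] z0 by (simp add: that split: if_splits)
    then show "trunc_state A S z 0 x"
      unfolding trunc_state_def by blast
  qed
  then obtain G where "F ** G = mat 1"
    by (metis matrix_left_invertible_ker matrix_left_right_inverse)
  then have *: "F *v (G *v g) = g" for g
    by (simp add: matrix_vector_mul_assoc)
  have "trunc_state A S z f (G *v (\<chi> i. if i \<in> S then f $ i else 0))"
    unfolding trunc_state_def
  proof
    fix i
    let ?g = "\<chi> i. if i \<in> S then f $ i else 0"
    have "(F *v (G *v ?g)) $ i = (if i \<in> S then f $ i else 0)"
      by (simp only: *) simp
    then show "if i \<in> S then z * (G *v ?g) $ i = (cmat A *v (G *v ?g)) $ i + f $ i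
        else (G *v ?g) $ i = 0"
      using z0 unfolding F by (cases "i \<in> S") (simp_all add: diff_eq_eq add.commute)
  qed
  then show ?thesis ..
qed

text \<open>The difference \<open>d\<close> is measured by the observability Gramian and the sum
  \<open>s\<close> by the inverse controllability Gramian. The state equation that \<open>w\<close>
  violates at \<open>k\<close> enters the two balances with opposite signs.\<close>

lemma trunc_state_remove_one:
  fixes A :: "real^'n^'n" and B :: "real^'m^'n" and C :: "real^'n^'p"
  assumes obs: "transpose A ** diag p + diag p ** A + transpose C ** C = 0"
    and ctrl: "A ** diag p + diag p ** transpose A + B ** transpose B = 0"
    and pos: "\<And>i. 0 < p i" and z: "0 < Re z"
    and x: "trunc_state A (insert k S) z (cmat B *v u) x"
    and w: "trunc_state A S z (cmat B *v u) w"
    and k: "k \<notin> S"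
  shows "norm (cmat C *v (x - w)) \<le> 2 * p k * norm u"
proof -
  define d s where "d = x - w" and "s = x + w"
  define q where "q i = inverse (p i)" for i
  have pq: "diag p ** diag q = mat 1" "diag q ** diag p = mat 1"
    using pos by (simp_all add: vec_eq_iff q_def mat_def less_imp_neq[symmetric])
  \<comment> \<open>Multiplying by the inverse Gramian on both sides turns the controllability
    equation into one of observability type with output matrix
    \<open>transpose B ** diag q\<close>.\<close>
  have "0 = diag q ** (A ** diag p + diag p ** transpose A + B ** transpose B) ** diag q"
    by (simp only: ctrl times0_left times0_right)
  also have "diag q ** (A ** diag p + diag p ** transpose A + B ** transpose B) ** diag q
      = diag q ** A ** (diag p ** diag q) + (diag q ** diag p) ** transpose A ** diag q
        + diag q ** B ** transpose B ** diag q"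
    by (simp add: matrix_ring_simps)
  finally have ctrl': "transpose A ** diag q + diag q ** A
      + transpose (transpose B ** diag q) ** (transpose B ** diag q) = 0"
    by (simp add: pq transpose_simps matrix_mul_assoc add.commute)
  \<comment> \<open>Since \<open>w $ k = 0\<close>, the number \<eta> is the residual of
    \<open>w\<close> in the state equation at the removed index \<open>k\<close>; \<open>e\<close>
    places it there.\<close>
  define \<eta> where "\<eta> = (cmat A *v w + cmat B *v u) $ k"
  define e where "e = (axis k \<eta> :: complex^'n)"
  define W where "W r v = (\<Sum>i\<in>UNIV. r i * (norm (v $ i))\<^sup>2)" for r :: "'n \<Rightarrow> real" and v :: "complex^'n"
  have W_nonneg: "0 \<le> W r v" if "\<And>i. 0 < r i" for r v
    unfolding W_def using that by (intro sum_nonneg) (simp add: less_imp_le)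
  have W: "(cmat (diag r) *v v) \<bullet> (z *s v) = Re z * W r v" for r v
    unfolding W_def by (simp add: inner_vec_def sum_distrib_left inner_complex_def cmod_power2)
       (simp add: algebra_simps power2_eq_square)
  have wk: "w $ k = 0"
    using w k by (simp add: trunc_state_def)
  have e_inner: "(cmat (diag r) *v v) \<bullet> e = r k * (v $ k \<bullet> \<eta>)" for r v
    by (simp add: e_def inner_axis inner_complex_def algebra_simps)
  have d_eq: "d $ i = 0 \<or> (z *s d) $ i = (cmat A *v d + e) $ i" for i
    using x[unfolded trunc_state_def, rule_format, of i] w[unfolded trunc_state_def, rule_format, of i] k
    by (auto simp: d_def e_def \<eta>_def axis_def algebra_simps split: if_splits)
  have s_eq: "s $ i = 0 \<or> (z *s s) $ i = (cmat A *v s + 2 *\<^sub>R (cmat B *v u) - e) $ i" for i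
    using x[unfolded trunc_state_def, rule_format, of i] w[unfolded trunc_state_def, rule_format, of i] k
    by (auto simp: s_def e_def \<eta>_def axis_def algebra_simps scaleR_2 split: if_splits)
  have inner_eq: "(cmat (diag r) *v v) \<bullet> f = (cmat (diag r) *v v) \<bullet> g"
    if "\<And>i. v $ i = 0 \<or> f $ i = g $ i" for r and v f g :: "complex^'n"
    unfolding inner_vec_def
    by (intro sum.cong refl) (metis that cmat_diag_mult_vec_nth inner_zero_left mult_zero_right)
  have d_bal: "2 * (Re z * W p d) = - (norm (cmat C *v d))\<^sup>2 + 2 * (p k * (x $ k \<bullet> \<eta>))"
  proof -
    have "(cmat (diag p) *v d) \<bullet> (z *s d) = (cmat (diag p) *v d) \<bullet> (cmat A *v d + e)"
      by (rule inner_eq[OF d_eq])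
    moreover have "d $ k = x $ k"
      by (simp add: d_def wk)
    ultimately show ?thesis
      using lyapunov_inner[OF obs transpose_diag, of d] by (simp add: W e_inner inner_add_right)
  qed
  have s_bal: "2 * (Re z * W q s) = - (norm (cmat (transpose B ** diag q) *v s))\<^sup>2
      + 4 * ((cmat (transpose B ** diag q) *v s) \<bullet> u) - 2 * (q k * (x $ k \<bullet> \<eta>))"
  proof -
    have "(cmat (diag q) *v s) \<bullet> (cmat B *v u) = (cmat (transpose B ** diag q) *v s) \<bullet> u"
      by (simp add: inner_cmat_right[of _ B] cmat_mult del: transpose_matrix_vector flip: matrix_vector_mul_assoc)
    moreover have "(cmat (diag q) *v s) \<bullet> (z *s s)
        = (cmat (diag q) *v s) \<bullet> (cmat A *v s + 2 *\<^sub>R (cmat B *v u) - e)"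
      by (rule inner_eq[OF s_eq])
    moreover have "s $ k = x $ k"
      by (simp add: s_def wk)
    ultimately show ?thesis
      using lyapunov_inner[OF ctrl' transpose_diag, of s]
      by (simp add: W e_inner inner_add_right inner_diff_right)
  qed
  \<comment> \<open>Completing the square in \<open>y - 2 *\<^sub>R u\<close> bounds the supplied
    energy.\<close>
  have "- (norm y)\<^sup>2 + 4 * (y \<bullet> u) \<le> 4 * (norm u)\<^sup>2" for y
    using inner_ge_zero[of "y - 2 *\<^sub>R u"]
    by (simp add: inner_diff inner_commute power2_norm_eq_inner algebra_simps)
  from this[of "cmat (transpose B ** diag q) *v s"]
  have "2 * (Re z * W q s) \<le> 4 * (norm u)\<^sup>2 - 2 * (q k * (x $ k \<bullet> \<eta>))"
    using s_bal by linarith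
  \<comment> \<open>The cross terms carry the weights \<open>p k\<close> and
    \<open>q k = inverse (p k)\<close>, so the factor \<open>(p k)\<^sup>2\<close> makes them cancel
    when the balances are added.\<close>
  then have "(p k)\<^sup>2 * (2 * (Re z * W q s)) \<le> (p k)\<^sup>2 * (4 * (norm u)\<^sup>2 - 2 * (q k * (x $ k \<bullet> \<eta>)))"
    by (intro mult_left_mono) auto
  also have "\<dots> = (2 * p k * norm u)\<^sup>2 - 2 * (p k * (x $ k \<bullet> \<eta>))"
    using pos[of k] by (simp add: q_def power2_eq_square field_simps)
  finally have "(norm (cmat C *v d))\<^sup>2 + 2 * (Re z * W p d) + (p k)\<^sup>2 * (2 * (Re z * W q s))
      \<le> (2 * p k * norm u)\<^sup>2"
    using d_bal by linarith
  moreover have "0 \<le> Re z * W p d" "0 \<le> (p k)\<^sup>2 * (2 * (Re z * W q s))"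
    using z pos W_nonneg[of p d] W_nonneg[of q s] by (simp_all add: q_def)
  ultimately have "(norm (cmat C *v d))\<^sup>2 \<le> (2 * p k * norm u)\<^sup>2"
    by linarith
  then show ?thesis
    using pos[of k] by (simp add: d_def power2_le_iff_abs_le)
qed

text \<open>Indices are removed one by one and the errors added by the triangle inequality. Padding
  by zeros lets the full-size Lyapunov equations serve at every stage.\<close>

lemma trunc_state_error:
  fixes A :: "real^'n^'n" and B :: "real^'m^'n" and C :: "real^'n^'p"
  assumes obs: "transpose A ** diag p + diag p ** A + transpose C ** C = 0"
    and ctrl: "A ** diag p + diag p ** transpose A + B ** transpose B = 0"
    and pos: "\<And>i. 0 < p i" and z: "0 < Re z"
    and x: "trunc_state A UNIV z (cmat B *v u) x"
    and w: "trunc_state A (- K) z (cmat B *v u) w"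
  shows "norm (cmat C *v (x - w)) \<le> 2 * (\<Sum>i\<in>K. p i) * norm u"
  using finite[of K] w
proof (induction K arbitrary: w rule: finite_induct)
  case empty
  have "trunc_state A UNIV z 0 (x - w)"
    using x empty by (simp add: trunc_state_def algebra_simps)
  then have "x - w = 0"
    by (rule trunc_state_homogeneous[OF obs pos z])
  then show ?case
    by simp
next
  case (insert k K)
  obtain v where v: "trunc_state A (- K) z (cmat B *v u) v"
    using trunc_state_exists[OF obs pos z] by blast
  have "insert k (- insert k K) = - K"
    using insert.hyps by auto
  then have "norm (cmat C *v (v - w)) \<le> 2 * p k * norm u"
    using trunc_state_remove_one[OF obs ctrl pos z, of k "- insert k K" u v w] v insert.prems by auto
  moreover have "cmat C *v (x - w) = cmat C *v (x - v) + cmat C *v (v - w)"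
    by (simp add: algebra_simps)
  ultimately show ?case
    using insert.IH[OF v] norm_triangle_ineq[of "cmat C *v (x - v)" "cmat C *v (v - w)"] insert.hyps
    by (simp add: algebra_simps)
qed

section \<open>Resolvents and the spectral factorization of the Popov function\<close>

lemma matrix_inv_invertible:
  assumes "invertible M"
  shows "M ** matrix_inv M = mat 1" "matrix_inv M ** M = mat 1"
  using someI_ex[OF assms[unfolded invertible_def]] by (simp_all add: matrix_inv_def)

lemma mat_mult_vec: "mat z *v x = z *s x" for z :: "'a::comm_semiring_1"
  by (simp add: vec_eq_iff matrix_vector_mult_def mat_def if_distribR if_distrib cong: if_cong)

lemma invertible_resolvent:
  assumes "\<And>v. cmat A *v v = z *s v \<Longrightarrow> v = 0"
  shows "invertible (mat z - cmat A)"
  using assms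
  by (auto simp: invertible_left_inverse matrix_left_invertible_ker matrix_vector_mult_diff_rdistrib
      mat_mult_vec)

lemma resolvent_state:
  fixes f :: "complex^'n" and A :: "real^'n^'n"
  assumes "invertible (mat z - cmat A)"
  defines "x \<equiv> matrix_inv (mat z - cmat A) *v f"
  shows "z *s x = cmat A *v x + f"
proof -
  have "(mat z - cmat A) *v x = f"
    by (simp add: x_def matrix_vector_mul_assoc matrix_inv_invertible[OF assms(1)])
  then show ?thesis
    by (simp add: matrix_vector_mult_diff_rdistrib mat_mult_vec algebra_simps)
qed

text \<open>Adding and subtracting \<open>s\<close> times \<open>X\<close> writes
  \<open>G ** transpose G\<close> through the two resolvent denominators. Between the resolvents it
  splits into two terms, and \<open>X ** transpose C = B\<close> identifies them with those of the
  Popov function.\<close>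

lemma popov_spectral_factor_lyapunov:
  fixes A X :: "real^'n^'n" and B :: "real^'m^'n" and C :: "real^'n^'m" and G :: "real^'p^'n"
  assumes lyap: "A ** X + X ** transpose A + G ** transpose G = 0"
    and sym: "transpose X = X" and XC: "X ** transpose C = B"
  shows "popov_spectral_factor (transfer A G C) A B C"
  unfolding popov_spectral_factor_def
proof (intro allI impI, elim conjE)
  fix s assume s: "\<not> is_eigenvalue A s" "\<not> is_eigenvalue A (- s)"
  have inv: "invertible (mat s - cmat A)" "invertible (mat (- s) - cmat A)"
    using s unfolding is_eigenvalue_def by (auto intro!: invertible_resolvent)
  define N M where "N = matrix_inv (mat s - cmat A)"
    and "M = transpose (matrix_inv (mat (- s) - cmat A))"
  have N: "N ** (mat s - cmat A) = mat 1"
    unfolding N_def by (rule matrix_inv_invertible[OF inv(1)])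
  have M: "(mat (- s) - transpose (cmat A)) ** M = mat 1"
    using arg_cong[OF matrix_inv_invertible(2)[OF inv(2)], of transpose]
    by (simp add: M_def transpose_simps)
  have mats: "mat s ** cmat X + cmat X ** mat (- s) = 0"
    by (simp add: vec_eq_iff matrix_matrix_mult_def mat_def if_distrib if_distribR cong: if_cong)
  have "cmat A ** cmat X + cmat X ** transpose (cmat A) + cmat G ** transpose (cmat G) = 0"
    using arg_cong[OF lyap, of cmat] by (simp only: cmat_add cmat_mult cmat_transpose cmat_0)
  then have GG: "cmat G ** transpose (cmat G)
      = (mat s - cmat A) ** cmat X + cmat X ** (mat (- s) - transpose (cmat A))"
    using mats by (simp add: matrix_diff_ldistrib matrix_diff_rdistrib algebra_simps add_eq_0_iff)
  have "N ** (cmat G ** transpose (cmat G)) ** M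
      = (N ** (mat s - cmat A)) ** cmat X ** M
        + N ** cmat X ** ((mat (- s) - transpose (cmat A)) ** M)"
    unfolding GG by (simp only: matrix_add_ldistrib matrix_add_rdistrib matrix_mul_assoc)
  then have NGM: "N ** cmat G ** transpose (cmat G) ** M = cmat X ** M + N ** cmat X"
    by (simp add: N M matrix_mul_assoc)
  have XCt: "cmat X ** transpose (cmat C) = cmat B"
    by (simp add: XC flip: cmat_mult cmat_transpose)
  have CX: "cmat C ** cmat X = transpose (cmat B)"
    using arg_cong[OF XC, of transpose] by (simp add: transpose_simps sym flip: cmat_mult cmat_transpose)
  have "transfer A G C s ** transpose (transfer A G C (- s))
      = cmat C ** (N ** cmat G ** transpose (cmat G) ** M) ** transpose (cmat C)"
    by (simp add: transfer_def N_def M_def transpose_simps matrix_mul_assoc)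
  also have "\<dots> = (cmat C ** cmat X) ** M ** transpose (cmat C)
      + cmat C ** N ** (cmat X ** transpose (cmat C))"
    unfolding NGM by (simp only: matrix_add_ldistrib matrix_add_rdistrib matrix_mul_assoc)
  also have "\<dots> = popov A B C s"
    by (simp add: CX XCt popov_def transfer_def N_def M_def transpose_simps matrix_mul_assoc)
  finally show "popov A B C s = transfer A G C s ** transpose (transfer A G C (- s))" ..
qed

section \<open>Truncation to the first summand of the index type and the error bound\<close>

lemma sum_UNIV_Plus: "sum f UNIV = (\<Sum>i\<in>UNIV. f (Inl i)) + (\<Sum>i\<in>UNIV. f (Inr i))"
  for f :: "'a::finite + 'b::finite \<Rightarrow> 'c::comm_monoid_add"
  by (simp add: sum.Plus flip: UNIV_Plus_UNIV)

definition extend_vec :: "complex^'r \<Rightarrow> complex^('r::finite + 'q::finite)" where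
  "extend_vec v = (\<chi> k. case k of Inl i \<Rightarrow> v $ i | Inr _ \<Rightarrow> 0)"

lemma extend_vec_nth [simp]: "extend_vec v $ Inl i = v $ i" "extend_vec v $ Inr j = 0"
  by (simp_all add: extend_vec_def)

lemma first_columns_mult_vec: "cmat (first_columns M) *v v = cmat M *v extend_vec v"
  by (simp add: vec_eq_iff matrix_vector_mult_def sum_UNIV_Plus first_columns_def)

text \<open>Identifies the zero-padded states used in the estimates with the genuine states of the
  reduced model.\<close>

lemma trunc_state_extend_vec:
  fixes A :: "real^('r::finite + 'q::finite)^('r + 'q)"
  shows "trunc_state A (- range Inr) z f (extend_vec v)
    \<longleftrightarrow> z *s v = cmat (leading_block A) *v v + (\<chi> i. f $ Inl i)"
proof -
  have "(cmat A *v extend_vec v) $ Inl i = (cmat (leading_block A) *v v) $ i" for i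
    by (simp add: matrix_vector_mult_def sum_UNIV_Plus leading_block_def)
  moreover have "(\<forall>k. P k) \<longleftrightarrow> (\<forall>i. P (Inl i)) \<and> (\<forall>j. P (Inr j))" for P :: "'r + 'q \<Rightarrow> bool"
    by (metis sum.exhaust)
  ultimately show ?thesis
    by (simp add: trunc_state_def vec_eq_iff image_iff)
qed

lemma trunc_state_UNIV: "trunc_state A UNIV z f x \<longleftrightarrow> z *s x = cmat A *v x + f"
  by (simp add: trunc_state_def vec_eq_iff)

text \<open>For fixed \<open>z\<close> and \<open>u\<close>, the two transfer functions return the
  outputs of the full and of the padded reduced state, so the state estimate bounds the operator
  norm at every \<open>z\<close>.\<close>

lemma balanced_truncation_error:
  fixes A :: "real^('r::finite + 'q::finite)^('r + 'q)" and B :: "real^'m^('r + 'q)"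
    and C :: "real^('r + 'q)^'p"
  assumes obs: "transpose A ** diag p + diag p ** A + transpose C ** C = 0"
    and ctrl: "A ** diag p + diag p ** transpose A + B ** transpose B = 0"
    and pos: "\<And>i. 0 < p i"
  shows "Hinf_norm (\<lambda>z. transfer A B C z
      - transfer (leading_block A) (first_rows B) (first_columns C) z)
    \<le> ereal (2 * (\<Sum>i\<in>UNIV. p (Inr i)))"
  unfolding Hinf_norm_def
proof (rule SUP_least, unfold ereal_less_eq, rule onorm_le)
  fix z u assume "z \<in> {z. 0 < Re z}"
  then have z: "0 < Re z"
    by simp
  let ?A = "leading_block A"
  \<comment> \<open>An eigenvector at \<open>z\<close> would be a nonzero homogeneous state. Hence
    \<open>matrix_inv\<close> is a true inverse here, and likewise for the leading block after
    padding.\<close>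
  have "invertible (mat z - cmat A)"
  proof (rule invertible_resolvent)
    fix v assume "cmat A *v v = z *s v"
    then show "v = 0"
      by (intro trunc_state_homogeneous[OF obs pos z, of UNIV]) (simp add: trunc_state_UNIV)
  qed
  note x = resolvent_state[OF this, of "cmat B *v u"]
  have "invertible (mat z - cmat ?A)"
  proof (rule invertible_resolvent)
    fix v assume "cmat ?A *v v = z *s v"
    then have "extend_vec v = (0 :: complex^('r + 'q))"
      by (intro trunc_state_homogeneous[OF obs pos z, of "- range Inr"])
        (simp add: trunc_state_extend_vec vec_eq_iff)
    then show "v = 0"
      by (metis extend_vec_nth(1) vec_eq_iff zero_index)
  qed
  note w = resolvent_state[OF this, of "cmat (first_rows B) *v u"]
  have first_rows: "cmat (first_rows B) *v u = (\<chi> i. (cmat B *v u) $ Inl i)"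
    by (simp add: vec_eq_iff matrix_vector_mult_def first_rows_def)
  define w where "w = matrix_inv (mat z - cmat ?A) *v (cmat (first_rows B) *v u)"
  define x where "x = matrix_inv (mat z - cmat A) *v (cmat B *v u)"
  have "norm (cmat C *v (x - extend_vec w)) \<le> 2 * (\<Sum>i\<in>range Inr. p i) * norm u"
    using x w
    by (intro trunc_state_error[OF obs ctrl pos z])
      (simp_all add: trunc_state_UNIV trunc_state_extend_vec x_def w_def first_rows)
  also have "(\<Sum>i\<in>range Inr. p i) = (\<Sum>i\<in>UNIV. p (Inr i))"
    by (simp add: sum.reindex)
  also have "cmat C *v (x - extend_vec w)
      = (transfer A B C z - transfer ?A (first_rows B) (first_columns C) z) *v u"
    by (simp add: transfer_def x_def w_def matrix_vector_mult_diff_distrib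
        matrix_vector_mult_diff_rdistrib first_columns_mult_vec flip: matrix_vector_mul_assoc)
  finally show "norm ((transfer A B C z - transfer ?A (first_rows B) (first_columns C) z) *v u)
      \<le> 2 * (\<Sum>i\<in>UNIV. p (Inr i)) * norm u" .
qed

section \<open>Structure preserved by taking leading blocks\<close>

lemma first_rows_transpose: "transpose (first_rows M) = first_columns (transpose M)"
  by (simp add: vec_eq_iff transpose_def first_rows_def first_columns_def)

lemma leading_block_transpose: "leading_block (transpose M) = transpose (leading_block M)"
  by (simp add: vec_eq_iff transpose_def leading_block_def)

lemma leading_block_mult: "leading_block (M ** N) = first_rows M ** first_columns N"
  by (simp add: vec_eq_iff matrix_matrix_mult_def first_rows_def first_columns_def leading_block_def)

lemma leading_block_diag_mult:
  "leading_block (diag d ** M) = diag (\<lambda>i. d (Inl i)) ** leading_block M"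
  by (simp add: vec_eq_iff leading_block_def)

lemma leading_block_mult_diag:
  "leading_block (M ** diag d) = leading_block M ** diag (\<lambda>i. d (Inl i))"
  by (simp add: vec_eq_iff leading_block_def)

lemma first_columns_mult_diag:
  "first_columns (M ** diag d) = first_columns M ** diag (\<lambda>i. d (Inl i))"
  by (simp add: vec_eq_iff first_columns_def)

lemma pos_semidef_leading_block:
  fixes R :: "real^('r::finite + 'q::finite)^('r + 'q)"
  assumes "pos_semidef R"
  shows "pos_semidef (leading_block R)"
proof -
  have "x \<bullet> (leading_block R *v x) \<ge> 0" for x :: "real^'r"
  proof -
    define y :: "real^('r + 'q)" where "y = (\<chi> k. case k of Inl i \<Rightarrow> x $ i | Inr _ \<Rightarrow> 0)"
    have "x \<bullet> (leading_block R *v x) = y \<bullet> (R *v y)"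
      by (simp add: inner_vec_def matrix_vector_mult_def sum_UNIV_Plus leading_block_def y_def)
    then show ?thesis
      using assms by (simp add: pos_semidef_def)
  qed
  then show ?thesis
    using assms by (simp add: pos_semidef_def flip: leading_block_transpose)
qed

lemma pos_def_diag: "pos_def (diag d) \<longleftrightarrow> (\<forall>i. 0 < d i)"
proof
  assume *: "pos_def (diag d)"
  have "axis i 1 \<bullet> (diag d *v axis i 1) = d i" for i
    by (simp add: inner_axis' matrix_vector_mult_basis column_def)
  then show "\<forall>i. 0 < d i"
    using * unfolding pos_def_def by (metis axis_eq_0_iff zero_neq_one)
next
  assume *: "\<forall>i. 0 < d i"
  have "0 < x \<bullet> (diag d *v x)" if "x \<noteq> 0" for x
  proof -
    obtain i where "x $ i \<noteq> 0"
      using \<open>x \<noteq> 0\<close> by (auto simp: vec_eq_iff)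
    have "x \<bullet> (diag d *v x) = (\<Sum>i\<in>UNIV. d i * (x $ i)\<^sup>2)"
      by (simp add: inner_vec_def matrix_vector_mult_def if_distribR if_distrib power2_eq_square
          algebra_simps cong: if_cong)
    also have "\<dots> > 0"
      using * \<open>x $ i \<noteq> 0\<close> by (intro sum_pos2[of _ i]) (simp_all add: less_imp_le)
    finally show ?thesis .
  qed
  then show "pos_def (diag d)"
    by (simp add: pos_def_def)
qed

text \<open>A diagonal energy matrix does not mix retained and discarded indices, so the leading
  block of \<open>(J - R) ** diag d\<close> is again a product of leading blocks.\<close>

lemma port_hamiltonian_truncation:
  assumes "port_hamiltonian_with J R (diag d) A B C"
  shows "port_hamiltonian_with (leading_block J) (leading_block R) (diag (\<lambda>i. d (Inl i)))
    (leading_block A) (first_rows B) (first_columns C)"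
proof -
  have "transpose (leading_block J) = - leading_block J"
    using assms by (simp add: port_hamiltonian_with_def flip: leading_block_transpose)
      (simp add: vec_eq_iff leading_block_def)
  moreover have "leading_block (J - R) = leading_block J - leading_block R"
    by (simp add: vec_eq_iff leading_block_def)
  ultimately show ?thesis
    using assms
    by (simp add: port_hamiltonian_with_def pos_semidef_leading_block pos_def_diag
        leading_block_mult_diag first_columns_mult_diag first_rows_transpose)
qed

text \<open>A diagonal Gramian passes through truncation, so the reduced model satisfies its own
  Lyapunov equation and has its own spectral factor.\<close>

lemma leading_block_lyapunov:
  assumes "A ** diag p + diag p ** transpose A + G ** transpose G = 0"
  shows "leading_block A ** diag (\<lambda>i. p (Inl i))
    + diag (\<lambda>i. p (Inl i)) ** transpose (leading_block A)
    + first_rows G ** transpose (first_rows G) = 0"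
proof -
  have add: "leading_block (M + N) = leading_block M + leading_block N" for M N
    by (simp add: vec_eq_iff leading_block_def)
  have zero: "leading_block 0 = 0"
    by (simp add: vec_eq_iff leading_block_def)
  show ?thesis
    using arg_cong[OF assms, of leading_block]
    by (simp add: add zero leading_block_mult_diag leading_block_diag_mult leading_block_transpose
        leading_block_mult[of G] first_rows_transpose)
qed

section \<open>Assembly for the balanced port-Hamiltonian system\<close>

theorem corollary16:
  fixes J R Q A Lc Mo :: "real^('r::finite + 'q::finite)^('r + 'q)"
    and B :: "real^'m^('r + 'q)"
    and C :: "real^('r + 'q)^'m"
    and LR :: "real^('r + 'q)^'p"
    and \<pi> :: "'r + 'q \<Rightarrow> real"
    and A\<^sub>r :: "real^'r^'r" and B\<^sub>r :: "real^'m^'r" and C\<^sub>r :: "real^'r^'m"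
    and V V\<^sub>r :: "complex \<Rightarrow> complex^'p^'m"
  assumes ph: "port_hamiltonian_with J R Q A B C"
    and stable: "asymptotically_stable A"
    and ctrl: "controllable A R"
    and obs: "observable A C"
    and lyap_c: "A ** Lc + Lc ** transpose A + 2 *\<^sub>R R = 0"
    and lyap_o: "transpose A ** Mo + Mo ** A + transpose C ** C = 0"
    and balanced: "Mo = diag \<pi>" "Lc = diag \<pi>"
    and factor: "2 *\<^sub>R R = transpose LR ** LR"
    and reduced: "A\<^sub>r = leading_block A" "B\<^sub>r = first_rows B" "C\<^sub>r = first_columns C"
    and V_def: "V = transfer A (transpose LR) C"
    and V\<^sub>r_def: "V\<^sub>r = transfer A\<^sub>r (first_rows (transpose LR)) C\<^sub>r"
  shows "popov_spectral_factor V A B C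
    \<and> popov_spectral_factor V\<^sub>r A\<^sub>r B\<^sub>r C\<^sub>r
    \<and> Hinf_norm (\<lambda>z. V z - V\<^sub>r z) \<le> ereal (2 * (\<Sum>i\<in>UNIV. \<pi> (Inr i)))
    \<and> port_hamiltonian A\<^sub>r B\<^sub>r C\<^sub>r"
proof -
  \<comment> \<open>Balancing makes the solution \<open>Lc\<close> diagonal, so its inverse
    \<open>Q\<close> must be diagonal too.\<close>
  have \<pi>Q: "diag \<pi> ** Q = mat 1"
    using port_hamiltonian_gramian[OF ph ctrl factor _ lyap_c] by (simp add: balanced)
  have Q: "pos_def Q" and C: "C = transpose B ** Q"
    using ph by (auto simp: port_hamiltonian_with_def)
  have entry: "\<pi> i * Q $ i $ j = (if i = j then 1 else 0)" for i j
    using arg_cong[OF \<pi>Q, of "\<lambda>M. M $ i $ j"] by (simp add: mat_def)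
  have \<pi>_nz: "\<pi> i \<noteq> 0" for i
    using entry[of i i] by auto
  have Q_diag: "Q = diag (\<lambda>i. 1 / \<pi> i)"
    using entry \<pi>_nz by (auto simp: vec_eq_iff nonzero_eq_divide_eq mult.commute)
      (metis mult_eq_0_iff)
  \<comment> \<open>Positivity of the \<pi> values is inherited from that of the energy
    matrix.\<close>
  have pos: "0 < \<pi> i" for i
    using Q unfolding Q_diag pos_def_diag by simp
  \<comment> \<open>Written with the factor \<open>LR\<close>, the equation is the controllability
    equation of the system with input matrix \<open>transpose LR\<close>, whose transfer function is
    \<open>V\<close>.\<close>
  have lyap: "A ** diag \<pi> + diag \<pi> ** transpose A + transpose LR ** transpose (transpose LR) = 0"
    using lyap_c by (simp add: balanced factor)
  have ph_r: "port_hamiltonian_with (leading_block J) (leading_block R)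
      (diag (\<lambda>i. 1 / \<pi> (Inl i))) A\<^sub>r B\<^sub>r C\<^sub>r"
    using port_hamiltonian_truncation[OF ph[unfolded Q_diag]] by (simp add: reduced)
  \<comment> \<open>This is the condition \<open>X ** transpose C = B\<close> of the factorization
    lemma, in a generality that covers both the full and the reduced system.\<close>
  have XC: "diag p ** transpose (transpose M ** diag (\<lambda>i. 1 / p i)) = M" if "\<And>i. p i \<noteq> 0"
    for p and M :: "real^'k^'l"
    using that by (simp add: transpose_simps vec_eq_iff)
  have "popov_spectral_factor V A B C"
    unfolding V_def by (rule popov_spectral_factor_lyapunov[OF lyap transpose_diag])
      (simp add: C Q_diag XC \<pi>_nz)
  moreover have "popov_spectral_factor V\<^sub>r A\<^sub>r B\<^sub>r C\<^sub>r"
    unfolding V\<^sub>r_def reduced(1)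
  proof (rule popov_spectral_factor_lyapunov[OF leading_block_lyapunov[OF lyap] transpose_diag])
    show "diag (\<lambda>i. \<pi> (Inl i)) ** transpose C\<^sub>r = B\<^sub>r"
      using ph_r by (simp add: port_hamiltonian_with_def XC \<pi>_nz)
  qed
  moreover have "Hinf_norm (\<lambda>z. V z - V\<^sub>r z) \<le> ereal (2 * (\<Sum>i\<in>UNIV. \<pi> (Inr i)))"
    unfolding V_def V\<^sub>r_def reduced
    by (rule balanced_truncation_error[OF lyap_o[unfolded balanced] lyap pos])
  moreover have "port_hamiltonian A\<^sub>r B\<^sub>r C\<^sub>r"
    using ph_r unfolding port_hamiltonian_def by blast
  ultimately show ?thesis
    by blast
qed

end
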